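(* Let $w_1,w_2$ be words in $\mathcal{H}^{2,3}=\mathbb{Z}\langle z_2,z_3\rangle$ (monomials in $z_2,z_3$), and let $Z_{\mathcal{A}}$, $\star$, $\mathrm{wt}$ and the reversal $\overleftarrow{w}$ be as defined in the context. Then, in the ring $\mathcal{A}=\prod_p\mathbb{Z}/p\mathbb{Z}\,\big/\bigoplus_p\mathbb{Z}/p\mathbb{Z}$, \[ (-1)^{\mathrm{wt}(w_2)}Z_{\mathcal{A}}(w_1\overleftarrow{w_2})=Z_{\mathcal{A}}(w_1\star w_2). \]
   Context: **Algebras.** $\mathcal{H}=\mathbb{Z}\langle x,y\rangle$ is the non-commutative polynomial ring over $\mathbb{Z}$ in two variables $x,y$. For each positive integer $k$ put $z_k=yx^{k-1}$. Then $\mathbb{Z}+y\mathcal{H}=\mathbb{Z}\langle z_1,z_2,\dots\rangle$, and $\mathcal{H}^{2,3}=\mathbb{Z}\langle z_2,z_3\rangle$ is a subring of it. A word in $\mathcal{H}^{2,3}$ is a (possibly empty) monomial in $z_2,z_3$. For a word $w=z_{k_1}\cdots z_{k_r}$, put $\overleftarrow{w}=z_{k_r}\cdots z_{k_1}$ and $\mathrm{wt}(w)=k_1+\cdots+k_r$. **The product $\star$.** $\star$ is the $\mathbb{Z}$-bilinear product on $\mathcal{H}^{2,3}$ defined inductively, for words $w,w'$ in $\mathcal{H}^{2,3}$, by - $w\star 1=1\star w=w$; - $wz_2\star w'=w\star w'z_2=(w\star w')z_2$; - $wz_3\star w'z_3=(w\star w'z_3)z_3+(wz_3\star w')z_3+(w\star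 w')z_2^3$. **Finite multiple zeta values.** Let $\mathcal{A}=\prod_p\mathbb{Z}/p\mathbb{Z}\,\big/\bigoplus_p\mathbb{Z}/p\mathbb{Z}$, where $p$ runs over all primes. For positive integers $k_1,\dots,k_r$ and a prime $p$, put \[ \zeta_p(k_1,\dots,k_r)=\sum_{0<n_1<\cdots<n_r<p}\frac{1}{n_1^{k_1}\cdots n_r^{k_r}},\qquad \zeta_{\mathcal{A}}(k_1,\dots,k_r)=(\zeta_p(k_1,\dots,k_r)\bmod p)_p\in\mathcal{A}. \] $Z_{\mathcal{A}}\colon\mathbb{Z}\langle z_1,z_2,\dots\rangle\to\mathcal{A}$ is the $\mathbb{Z}$-linear map with $Z_{\mathcal{A}}(1)=1$ and $Z_{\mathcal{A}}(z_{k_1}\cdots z_{k_r})=\zeta_{\mathcal{A}}(k_1,\dots,k_r)$. *)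

theory Defs
  imports "HOL-Library.Poly_Mapping" "HOL-Number_Theory.Number_Theory"
begin

section \<open>The free ring on two generators\<close>

text \<open>
  Words form a monoid under concatenation, written additively because
  \<^typ>\<open>'a \<Rightarrow>\<^sub>0 'b\<close> provides the monoid ring of an additive (not necessarily
  commutative) monoid.
\<close>

datatype 'a free_monoid = Word (letters: "'a list")

instantiation free_monoid :: (type) monoid_add
begin

definition zero_free_monoid :: "'a free_monoid" where
  "0 = Word []"

definition plus_free_monoid :: "'a free_monoid \<Rightarrow> 'a free_monoid \<Rightarrow> 'a free_monoid" where
  "u + v = Word (letters u @ letters v)"

instance
  by standard (simp_all add: zero_free_monoid_def plus_free_monoid_def)

end

datatype letter = X | Y

type_synonym H = "letter free_monoid \<Rightarrow>\<^sub>0 int"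

definition gen_x :: H where
  "gen_x = Poly_Mapping.single (Word [X]) 1"

definition gen_y :: H where
  "gen_y = Poly_Mapping.single (Word [Y]) 1"

definition zgen :: "nat \<Rightarrow> H" where
  "zgen k = gen_y * gen_x ^ (k - 1)"

text \<open>
  The monomial \<open>z\<^bsub>k\<^sub>1\<^esub> \<cdots> z\<^bsub>k\<^sub>r\<^esub>\<close> is represented by its index list \<open>[k\<^sub>1, \<dots>, k\<^sub>r]\<close>, which
  it determines when all indices are positive (lemma \<open>zmonom_inj\<close>). Words in
  \<open>\<int>\<langle>z\<^sub>2, z\<^sub>3\<rangle>\<close> are the monomials with index list in \<^term>\<open>lists {2, 3 :: nat}\<close>, and
  reversal of words is \<^const>\<open>rev\<close> on index lists.
\<close>

definition zword :: "nat list \<Rightarrow> H" where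
  "zword ks = prod_list (map zgen ks)"

definition wt :: "nat list \<Rightarrow> nat" where
  "wt ks = sum_list ks"

definition zmonom :: "nat list \<Rightarrow> letter free_monoid" where
  "zmonom ks = Word (concat (map (\<lambda>k. Y # replicate (k - 1) X) ks))"

lemma gen_x_power: "gen_x ^ n = Poly_Mapping.single (Word (replicate n X)) 1"
  by (induction n)
    (simp_all add: gen_x_def mult_single plus_free_monoid_def flip: zero_free_monoid_def)

lemma zword_eq_single: "zword ks = Poly_Mapping.single (zmonom ks) 1"
  by (induction ks)
    (simp_all add: zword_def zmonom_def zgen_def gen_x_power gen_y_def mult_single
      plus_free_monoid_def flip: zero_free_monoid_def)

lemma zword_append: "zword (us @ vs) = zword us * zword vs"
  by (simp add: zword_def)

lemma replicate_X_Y_cancel: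
  assumes "replicate m X @ us = replicate n X @ vs"
    and "us = [] \<or> hd us = Y" and "vs = [] \<or> hd vs = Y"
  shows "m = n \<and> us = vs"
  using assms
proof (induction m arbitrary: n)
  case 0
  then show ?case by (cases n) auto
next
  case (Suc m)
  then show ?case by (cases n) auto
qed

lemma zmonom_inj: "inj_on zmonom (lists {0<..})"
proof -
  have hdY: "concat (map (\<lambda>k. Y # replicate (k - 1) X) ks) = [] \<or>
      hd (concat (map (\<lambda>k. Y # replicate (k - 1) X) ks)) = Y" for ks :: "nat list"
    by (cases ks) auto
  have "us = vs" if "us \<in> lists {0<..}" "vs \<in> lists {0<..}" "zmonom us = zmonom vs" for us vs
    using that
  proof (induction us arbitrary: vs)
    case Nil
    then show ?case by (cases vs) (auto simp: zmonom_def)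
  next
    case (Cons a us)
    then obtain b vs' where vs: "vs = b # vs'"
      by (cases vs) (auto simp: zmonom_def)
    have eq: "a - 1 = b - 1 \<and> concat (map (\<lambda>k. Y # replicate (k - 1) X) us)
        = concat (map (\<lambda>k. Y # replicate (k - 1) X) vs')"
      using Cons.prems(2) by (intro replicate_X_Y_cancel hdY) (simp add: vs zmonom_def)
    have pos: "a > 0" "b > 0" "us \<in> lists {0<..}" "vs' \<in> lists {0<..}"
      using Cons.hyps Cons.prems by (auto simp: vs)
    have "a = b"
      using eq pos by linarith
    moreover have "us = vs'"
      using Cons.IH[of vs'] eq pos by (simp add: zmonom_def)
    ultimately show ?case
      by (simp add: vs)
  qed
  then show ?thesis by (intro inj_onI)
qed

definition zcoeff :: "H \<Rightarrow> nat list \<Rightarrow> int" where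
  "zcoeff f ks = Poly_Mapping.lookup f (zmonom ks)"

text \<open>
  The index lists with entries in \<open>S\<close> of the monomials occurring in \<open>f\<close>: the generators of
  \<open>\<int>\<langle>z\<^sub>1, z\<^sub>2, \<dots>\<rangle>\<close> correspond to \<open>S = {0<..}\<close>, those of \<open>\<int>\<langle>z\<^sub>2, z\<^sub>3\<rangle>\<close> to \<open>S = {2, 3}\<close>.
\<close>
definition zsupp :: "nat set \<Rightarrow> H \<Rightarrow> nat list set" where
  "zsupp S f = {ks \<in> lists S. zcoeff f ks \<noteq> 0}"

lemma zcoeff_zword:
  assumes "us \<in> lists {0<..}" "vs \<in> lists {0<..}"
  shows "zcoeff (zword us) vs = (if us = vs then 1 else 0)"
  using assms inj_onD[OF zmonom_inj, of us vs]
  by (auto simp: zcoeff_def zword_eq_single lookup_single)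

lemma zcoeff_add: "zcoeff (f + g) ks = zcoeff f ks + zcoeff g ks"
  by (simp add: zcoeff_def lookup_add)

lemma finite_zsupp:
  assumes "S \<subseteq> {0<..}"
  shows "finite (zsupp S f)"
proof (rule finite_imageD)
  show "finite (zmonom ` zsupp S f)"
    by (rule finite_subset[OF _ finite_lookup[of f]]) (auto simp: zsupp_def zcoeff_def)
  have "zsupp S f \<subseteq> lists {0<..}"
    using assms by (auto simp: zsupp_def)
  then show "inj_on zmonom (zsupp S f)"
    using zmonom_inj inj_on_subset by blast
qed

lemma zsupp_zword:
  assumes "S \<subseteq> {0<..}" "ks \<in> lists S"
  shows "zsupp S (zword ks) = {ks}"
proof -
  have "zcoeff (zword ks) vs = (if ks = vs then 1 else 0)" if "vs \<in> lists S" for vs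
    using that assms lists_mono[OF assms(1)] by (intro zcoeff_zword) blast+
  then have "vs \<in> zsupp S (zword ks) \<longleftrightarrow> vs = ks" for vs
    using assms(2) by (cases "vs \<in> lists S") (auto simp: zsupp_def simp del: in_lists_conv_set)
  then show ?thesis by blast
qed


section \<open>The product \<open>\<star>\<close>\<close>

text \<open>
  The recursion strips letters off the right-hand end of both words, so the arguments of the
  auxiliary function are the reversed index lists; every letter other than \<open>2\<close> is treated as
  \<open>3\<close>. The defining equations in their usual form are the lemmas \<open>star_one_left\<close> to
  \<open>star_z3_z3\<close>.
\<close>

fun star_rev :: "nat list \<Rightarrow> nat list \<Rightarrow> H" where
  "star_rev [] vs = zword (rev vs)"
| "star_rev (a # us) [] = zword (rev (a # us))"
| "star_rev (a # us) (b # vs) =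
     (if a = 2 then star_rev us (b # vs) * zgen 2
      else if b = 2 then star_rev (a # us) vs * zgen 2
      else star_rev us (b # vs) * zgen 3 + star_rev (a # us) vs * zgen 3 + star_rev us vs * zgen 2 ^ 3)"

text \<open>
  The bilinear extension. Only its values on \<open>\<int>\<langle>z\<^sub>2, z\<^sub>3\<rangle>\<close> are meaningful; all other monomials
  are ignored.
\<close>
definition star :: "H \<Rightarrow> H \<Rightarrow> H"  (infixl "\<star>" 70) where
  "f \<star> g = (\<Sum>us\<in>zsupp {2, 3} f. \<Sum>vs\<in>zsupp {2, 3} g.
     of_int (zcoeff f us * zcoeff g vs) * star_rev (rev us) (rev vs))"

lemma star_zword:
  assumes "us \<in> lists {2, 3}" "vs \<in> lists {2, 3}"
  shows "zword us \<star> zword vs = star_rev (rev us) (rev vs)"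
proof -
  have pos: "ws \<in> lists {0<..}" if "ws \<in> lists {2, 3}" for ws :: "nat list"
    using that by (induction ws) auto
  show ?thesis
    using assms by (simp add: star_def zsupp_zword zcoeff_zword pos del: in_lists_conv_set)
qed

lemma star_superset:
  assumes "finite A" "zsupp {2, 3} f \<subseteq> A" "A \<subseteq> lists {2, 3}"
    and "finite B" "zsupp {2, 3} g \<subseteq> B" "B \<subseteq> lists {2, 3}"
  shows "f \<star> g = (\<Sum>us\<in>A. \<Sum>vs\<in>B.
     of_int (zcoeff f us * zcoeff g vs) * star_rev (rev us) (rev vs))"
proof -
  have f0: "zcoeff f us = 0" if "us \<in> A - zsupp {2, 3} f" for us
    using that assms(3) by (auto simp: zsupp_def)
  have g0: "zcoeff g vs = 0" if "vs \<in> B - zsupp {2, 3} g" for vs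
    using that assms(6) by (auto simp: zsupp_def)
  have "f \<star> g = (\<Sum>us\<in>zsupp {2, 3} f. \<Sum>vs\<in>B.
     of_int (zcoeff f us * zcoeff g vs) * star_rev (rev us) (rev vs))"
    unfolding star_def by (intro sum.cong sum.mono_neutral_left refl assms) (auto simp: g0)
  also have "\<dots> = (\<Sum>us\<in>A. \<Sum>vs\<in>B.
     of_int (zcoeff f us * zcoeff g vs) * star_rev (rev us) (rev vs))"
    by (intro sum.mono_neutral_left assms) (auto simp: f0)
  finally show ?thesis .
qed

lemma star_add_left: "(f + g) \<star> h = f \<star> h + g \<star> h"
proof -
  define A where "A = zsupp {2, 3} (f + g) \<union> zsupp {2, 3} f \<union> zsupp {2, 3} g"
  have A: "finite A" "A \<subseteq> lists {2, 3}"
    by (auto simp: A_def finite_zsupp) (auto simp: zsupp_def)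
  have B: "finite (zsupp {2, 3} h)" "zsupp {2, 3} h \<subseteq> lists {2, 3}"
    by (auto simp: finite_zsupp) (auto simp: zsupp_def)
  have "k \<star> h = (\<Sum>us\<in>A. \<Sum>vs\<in>zsupp {2, 3} h.
      of_int (zcoeff k us * zcoeff h vs) * star_rev (rev us) (rev vs))"
    if "zsupp {2, 3} k \<subseteq> A" for k
    using that A B by (intro star_superset) auto
  from this[of "f + g"] this[of f] this[of g] show ?thesis
    by (simp add: A_def zcoeff_add ring_distribs sum.distrib Un_assoc le_supI1 le_supI2)
qed

lemma star_add_right: "f \<star> (g + h) = f \<star> g + f \<star> h"
proof -
  define A where "A = zsupp {2, 3} (g + h) \<union> zsupp {2, 3} g \<union> zsupp {2, 3} h"
  have A: "finite A" "A \<subseteq> lists {2, 3}"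
    by (auto simp: A_def finite_zsupp) (auto simp: zsupp_def)
  have B: "finite (zsupp {2, 3} f)" "zsupp {2, 3} f \<subseteq> lists {2, 3}"
    by (auto simp: finite_zsupp) (auto simp: zsupp_def)
  have "f \<star> k = (\<Sum>us\<in>zsupp {2, 3} f. \<Sum>vs\<in>A.
      of_int (zcoeff f us * zcoeff k vs) * star_rev (rev us) (rev vs))"
    if "zsupp {2, 3} k \<subseteq> A" for k
    using that A B by (intro star_superset) auto
  from this[of "g + h"] this[of g] this[of h] show ?thesis
    by (simp add: A_def zcoeff_add ring_distribs sum.distrib Un_assoc le_supI1 le_supI2)
qed

lemma zword_Nil [simp]: "zword [] = 1"
  by (simp add: zword_def)

lemma zword_snoc: "zword (us @ [k]) = zword us * zgen k"
  by (simp add: zword_def)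

lemma star_one_left:
  assumes "us \<in> lists {2, 3}"
  shows "1 \<star> zword us = zword us"
  using star_zword[of "[]" us] assms by simp

lemma star_one_right:
  assumes "us \<in> lists {2, 3}"
  shows "zword us \<star> 1 = zword us"
  using star_zword[of us "[]"] assms by (cases us rule: rev_cases) auto

lemma star_rev_Nil_right: "star_rev us [] = zword (rev us)"
  by (cases us) auto

lemma star_rev_2_left: "star_rev (2 # us) vs = star_rev us vs * zgen 2"
  by (cases vs) (auto simp: zword_snoc star_rev_Nil_right)

lemma star_rev_2_right: "star_rev us (2 # vs) = star_rev us vs * zgen 2"
proof (induction us)
  case Nil
  show ?case by (simp add: zword_snoc)
next
  case (Cons a us)
  then show ?case by (cases "a = 2") (simp_all add: star_rev_2_left)
qed

lemma star_z2_left: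
  assumes "us \<in> lists {2, 3}" "vs \<in> lists {2, 3}"
  shows "(zword us * zgen 2) \<star> zword vs = (zword us \<star> zword vs) * zgen 2"
  using assms star_zword[of "us @ [2]" vs] star_zword[of us vs]
  by (simp add: zword_snoc star_rev_2_left)

lemma star_z2_right:
  assumes "us \<in> lists {2, 3}" "vs \<in> lists {2, 3}"
  shows "zword us \<star> (zword vs * zgen 2) = (zword us \<star> zword vs) * zgen 2"
  using assms star_zword[of us "vs @ [2]"] star_zword[of us vs]
  by (simp add: zword_snoc star_rev_2_right)

lemma star_z3_z3:
  assumes "us \<in> lists {2, 3}" "vs \<in> lists {2, 3}"
  shows "(zword us * zgen 3) \<star> (zword vs * zgen 3) =
    (zword us \<star> (zword vs * zgen 3)) * zgen 3 + ((zword us * zgen 3) \<star> zword vs) * zgen 3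
      + (zword us \<star> zword vs) * zgen 2 ^ 3"
  using assms star_zword[of "us @ [3]" "vs @ [3]"] star_zword[of us "vs @ [3]"]
    star_zword[of "us @ [3]" vs] star_zword[of us vs]
  by (simp add: zword_snoc)


section \<open>The ring \<open>\<A> = (\<Prod>\<^sub>p \<int>/p\<int>) / (\<Oplus>\<^sub>p \<int>/p\<int>)\<close>\<close>

text \<open>
  \<open>\<Prod>\<^sub>p \<int>/p\<int>\<close>: families of integers, where the entry at each prime \<open>p\<close> only matters modulo \<open>p\<close>
  and the entries at non-primes do not matter at all.
\<close>

definition prod_rel :: "(nat \<Rightarrow> int) \<Rightarrow> (nat \<Rightarrow> int) \<Rightarrow> bool" where
  "prod_rel f g \<longleftrightarrow> (\<forall>p. prime p \<longrightarrow> [f p = g p] (mod int p))"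

quotient_type prod_Zp = "nat \<Rightarrow> int" / prod_rel
  by (rule equivpI)
    (auto simp: prod_rel_def reflp_def symp_def transp_def intro: cong_sym cong_trans)

instantiation prod_Zp :: comm_ring_1
begin

lift_definition zero_prod_Zp :: prod_Zp is "\<lambda>p. 0" .

lift_definition one_prod_Zp :: prod_Zp is "\<lambda>p. 1" .

lift_definition plus_prod_Zp :: "prod_Zp \<Rightarrow> prod_Zp \<Rightarrow> prod_Zp" is "\<lambda>f g p. f p + g p"
  by (simp add: prod_rel_def cong_add)

lift_definition minus_prod_Zp :: "prod_Zp \<Rightarrow> prod_Zp \<Rightarrow> prod_Zp" is "\<lambda>f g p. f p - g p"
  by (simp add: prod_rel_def cong_diff)

lift_definition uminus_prod_Zp :: "prod_Zp \<Rightarrow> prod_Zp" is "\<lambda>f p. - f p"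
  by (simp add: prod_rel_def cong_minus_minus_iff)

lift_definition times_prod_Zp :: "prod_Zp \<Rightarrow> prod_Zp \<Rightarrow> prod_Zp" is "\<lambda>f g p. f p * g p"
  by (simp add: prod_rel_def cong_mult)

instance
proof
  show "(0 :: prod_Zp) \<noteq> 1"
    by transfer (auto simp: prod_rel_def cong_def intro!: exI[of _ 2])
qed (transfer; simp add: prod_rel_def algebra_simps)+

end

lift_definition vanishes_at :: "prod_Zp \<Rightarrow> nat \<Rightarrow> bool" is
  "\<lambda>f p. prime p \<longrightarrow> [f p = 0] (mod int p)"
  unfolding prod_rel_def using cong_sym cong_trans by blast

definition dirsum_Zp :: "prod_Zp set" where
  "dirsum_Zp = {a. finite {p. prime p \<and> \<not> vanishes_at a p}}"

lemma dirsum_Zp_zero: "0 \<in> dirsum_Zp"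
  unfolding dirsum_Zp_def mem_Collect_eq by transfer simp

lemma dirsum_Zp_uminus: "a \<in> dirsum_Zp \<Longrightarrow> - a \<in> dirsum_Zp"
  unfolding dirsum_Zp_def mem_Collect_eq by transfer (simp add: cong_0_iff)

lemma vanishes_at_add: "vanishes_at a p \<Longrightarrow> vanishes_at b p \<Longrightarrow> vanishes_at (a + b) p"
  by transfer (simp add: cong_0_iff)

lemma vanishes_at_mult: "vanishes_at a p \<Longrightarrow> vanishes_at (c * a) p"
  by transfer (simp add: cong_0_iff)

lemma dirsum_Zp_add: "a \<in> dirsum_Zp \<Longrightarrow> b \<in> dirsum_Zp \<Longrightarrow> a + b \<in> dirsum_Zp"
  unfolding dirsum_Zp_def mem_Collect_eq
  by (rule finite_subset[where B = "{p. prime p \<and> \<not> vanishes_at a p}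
      \<union> {p. prime p \<and> \<not> vanishes_at b p}"]) (auto dest: vanishes_at_add)

lemma dirsum_Zp_mult: "a \<in> dirsum_Zp \<Longrightarrow> c * a \<in> dirsum_Zp"
  unfolding dirsum_Zp_def mem_Collect_eq
  by (rule finite_subset[rotated]) (auto dest: vanishes_at_mult)

definition A_rel :: "prod_Zp \<Rightarrow> prod_Zp \<Rightarrow> bool" where
  "A_rel a b \<longleftrightarrow> a - b \<in> dirsum_Zp"

quotient_type ring_A = prod_Zp / A_rel
proof (rule equivpI)
  show "reflp A_rel"
    by (simp add: reflp_def A_rel_def dirsum_Zp_zero)
  show "symp A_rel"
    using dirsum_Zp_uminus by (force simp: symp_def A_rel_def)
  show "transp A_rel"
    using dirsum_Zp_add by (force simp: transp_def A_rel_def)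
qed

instantiation ring_A :: comm_ring_1
begin

lift_definition zero_ring_A :: ring_A is 0 .

lift_definition one_ring_A :: ring_A is 1 .

lift_definition plus_ring_A :: "ring_A \<Rightarrow> ring_A \<Rightarrow> ring_A" is "(+)"
  unfolding A_rel_def by (drule (1) dirsum_Zp_add) (simp add: algebra_simps)

lift_definition minus_ring_A :: "ring_A \<Rightarrow> ring_A \<Rightarrow> ring_A" is "(-)"
proof -
  fix a b c d assume "A_rel a b" "A_rel c d"
  then have "(a - b) + - (c - d) \<in> dirsum_Zp"
    unfolding A_rel_def by (intro dirsum_Zp_add dirsum_Zp_uminus)
  then show "A_rel (a - c) (b - d)"
    by (simp add: A_rel_def algebra_simps)
qed

lift_definition uminus_ring_A :: "ring_A \<Rightarrow> ring_A" is uminus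
  unfolding A_rel_def by (drule dirsum_Zp_uminus) (simp add: algebra_simps)

lift_definition times_ring_A :: "ring_A \<Rightarrow> ring_A \<Rightarrow> ring_A" is "(*)"
proof -
  fix a b c d assume "A_rel a b" "A_rel c d"
  then have "c * (a - b) + b * (c - d) \<in> dirsum_Zp"
    unfolding A_rel_def by (intro dirsum_Zp_add dirsum_Zp_mult)
  then show "A_rel (a * c) (b * d)"
    by (simp add: A_rel_def algebra_simps)
qed

instance
proof
  have "{p :: nat. prime p \<and> \<not> vanishes_at (0 - 1) p} = {p. prime p}"
    by transfer (auto simp: cong_0_iff)
  then show "(0 :: ring_A) \<noteq> 1"
    by transfer (simp add: A_rel_def dirsum_Zp_def primes_infinite)
qed (transfer; simp add: A_rel_def dirsum_Zp_zero algebra_simps)+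

end


section \<open>Finite multiple zeta values\<close>

text \<open>
  An integer representing \<open>\<zeta>\<^sub>p(k\<^sub>1, \<dots>, k\<^sub>r) mod p\<close>. The list \<open>ns\<close> runs over the tuples
  \<open>0 < n\<^sub>1 < \<cdots> < n\<^sub>r < p\<close>, and \<^term>\<open>modular_inverse (int p) (int n)\<close> represents \<open>1 / n\<close>
  in \<open>\<int>/p\<int>\<close>.
\<close>
definition zeta_p :: "nat \<Rightarrow> nat list \<Rightarrow> int" where
  "zeta_p p ks = (\<Sum>ns | length ns = length ks \<and> sorted_wrt (<) ns \<and> set ns \<subseteq> {0<..<p}.
     \<Prod>i<length ks. modular_inverse (int p) (int (ns ! i)) ^ (ks ! i))"

definition zeta_A :: "nat list \<Rightarrow> ring_A" where
  "zeta_A ks = abs_ring_A (abs_prod_Zp (\<lambda>p. zeta_p p ks))"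

text \<open>
  Only the values of \<open>Z\<^sub>\<A>\<close> on \<open>\<int>\<langle>z\<^sub>1, z\<^sub>2, \<dots>\<rangle>\<close> are meaningful; all other monomials are
  ignored.
\<close>
definition Z_A :: "H \<Rightarrow> ring_A" where
  "Z_A f = (\<Sum>ks\<in>zsupp {0<..} f. of_int (zcoeff f ks) * zeta_A ks)"

lemma Z_A_zword:
  assumes "ks \<in> lists {0<..}"
  shows "Z_A (zword ks) = zeta_A ks"
  using assms by (simp add: Z_A_def zsupp_zword zcoeff_zword del: in_lists_conv_set)

lemma Z_A_one: "Z_A 1 = 1"
proof -
  have "zeta_p p [] = 1" for p
  proof -
    have "{ns :: nat list. length ns = 0 \<and> sorted_wrt (<) ns \<and> set ns \<subseteq> {0<..<p}} = {[]}"
      by auto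
    then show ?thesis by (simp add: zeta_p_def)
  qed
  then have "zeta_A [] = 1"
    by (simp add: zeta_A_def one_ring_A_def one_prod_Zp_def)
  then show ?thesis
    using Z_A_zword[of "[]"] by simp
qed

lemma Z_A_add: "Z_A (f + g) = Z_A f + Z_A g"
proof -
  define A where "A = zsupp {0<..} (f + g) \<union> zsupp {0<..} f \<union> zsupp {0<..} g"
  have A: "finite A" "A \<subseteq> lists {0<..}"
    by (auto simp: A_def finite_zsupp) (auto simp: zsupp_def)
  have "Z_A h = (\<Sum>ks\<in>A. of_int (zcoeff h ks) * zeta_A ks)" if "zsupp {0<..} h \<subseteq> A" for h
    unfolding Z_A_def using that A
    by (intro sum.mono_neutral_left) (auto simp: zsupp_def)
  from this[of "f + g"] this[of f] this[of g] show ?thesis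
    by (simp add: A_def zcoeff_add ring_distribs sum.distrib Un_assoc le_supI1 le_supI2)
qed

end

theory Submission
  imports Defs
begin

text \<open>
  For \<open>N > 0\<close> and \<open>n + m < N\<close> let \<open>C\<^sub>N(n, m) = (N-1-n choose m) / ((N-1 choose m) (n+m choose n))\<close>, and
  let \<open>C\<^sub>N(n, m) = 0\<close> otherwise. For words \<open>w\<close>, \<open>w'\<close> in \<open>z\<^sub>2, z\<^sub>3\<close> with index lists \<open>k\<close>, \<open>l\<close>, the connected sum
  \<open>\<Sum> C\<^sub>N(n\<^sub>r, m\<^sub>s) / (n\<^sub>1^k\<^sub>1 \<cdots> n\<^sub>r^k\<^sub>r m\<^sub>1^l\<^sub>1 \<cdots> m\<^sub>s^l\<^sub>s)\<close> over \<open>0 < n\<^sub>1 < \<cdots> < n\<^sub>r\<close> and \<open>0 < m\<^sub>1 < \<cdots> < m\<^sub>s\<close>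
  (where \<open>n\<^sub>0 = m\<^sub>0 = 0\<close>) is a rational number equal to the truncation at \<open>N\<close> of the multiple harmonic sum of \<open>w \<star> w'\<close>:
  as \<open>N\<close> grows by one, both sides change by the recursion defining \<open>\<star>\<close>. For connected sums this
  comes down to two identities for \<open>\<Delta> = C\<^sub>N\<^sub>+\<^sub>1(n, m) - C\<^sub>N(n, m)\<close>, namely
  \<open>N\<^sup>2 \<Delta> = n\<^sup>2 (C\<^sub>N(n - 1, m) - C\<^sub>N(n, m))\<close> and \<open>N (N - n - m) \<Delta> = n m C\<^sub>N(n, m)\<close>.

  For a prime \<open>N = p\<close>, Wilson's theorem gives \<open>C\<^sub>p(n, m) \<equiv> 1\<close> modulo \<open>p\<close> whenever \<open>n + m < p\<close>, so the
  connected sum becomes the sum over \<open>n\<^sub>r < p - m\<^sub>s\<close>. Replacing each \<open>m\<^sub>i\<close> by \<open>p - m\<^sub>i\<close> turns it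
  into \<open>(-1)^wt(w')\<close> times the sum for \<open>w\<close> followed by the reversal of \<open>w'\<close>.
\<close>

section \<open>Nested sums and the connector\<close>

text \<open>
  The index list is reversed, so its head is the exponent of the largest summation variable,
  which takes the value \<open>n\<close>; the function \<open>g\<close> plays the role of \<open>n \<mapsto> 1/n\<close>.
\<close>

fun hterm :: "(nat \<Rightarrow> 'a::comm_semiring_1) \<Rightarrow> nat list \<Rightarrow> nat \<Rightarrow> 'a" where
  "hterm g [] n = of_bool (n = 0)"
| "hterm g (k # ks) n = g n ^ k * (\<Sum>a<n. hterm g ks a)"

text \<open>The quotient of binomials is expanded into factorials: the symmetry in \<open>n\<close>
  and \<open>m\<close> becomes visible, and for prime \<open>N\<close> every factorial is invertible
  modulo \<open>N\<close>, its argument being below \<open>N\<close>.\<close>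

definition conn :: "nat \<Rightarrow> nat \<Rightarrow> nat \<Rightarrow> rat" where
  "conn N n m = (if n + m < N then
     fact n * fact m * fact (N - 1 - n) * fact (N - 1 - m) /
       (fact (n + m) * fact (N - 1) * fact (N - 1 - n - m)) else 0)"

lemma conn_commute: "conn N n m = conn N m n"
  by (simp add: conn_def add.commute diff_right_commute mult_ac)

lemma conn_0_left: "conn N 0 m = of_bool (m < N)"
  by (simp add: conn_def)

lemma conn_eq_0: "N \<le> n + m \<Longrightarrow> conn N n m = 0"
  by (simp add: conn_def)

text \<open>Dividing by the square of \<open>Suc n\<close> turns growth in \<open>N\<close> into a
  difference in the first argument, ready for summation by parts.\<close>

lemma conn_diff:
  assumes "N > 0"
  shows "(of_nat N)\<^sup>2 * (conn (Suc N) (Suc n) m - conn N (Suc n) m)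
    = (of_nat (Suc n))\<^sup>2 * (conn N n m - conn N (Suc n) m)"
proof -
  consider (gt) "Suc n + m > N" | (eq) "N = Suc n + m" | (lt) "Suc n + m < N"
    by linarith
  then show ?thesis
  proof cases
    case gt
    then show ?thesis by (simp add: conn_def)
  next
    \<comment> \<open>On this boundary \<open>conn N (Suc n) m\<close> is cut off to 0, while the
      other two connectors are not.\<close>
    case eq
    then show ?thesis
      by (simp add: conn_def divide_simps power2_eq_square)
  next
    case lt
    then obtain j where j: "N = Suc (Suc n + m + j)"
      using less_iff_Suc_add by blast
    show ?thesis
      by (simp add: conn_def j divide_simps power2_eq_square add_ac)
         (simp add: algebra_simps)
  qed
qed

text \<open>For \<open>n + m < N\<close> the ratio of the two connectors is
  \<open>(N - n) * (N - m) / (N * (N - n - m))\<close>, and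
  \<open>(N - n) * (N - m) - N * (N - n - m) = n * m\<close>.\<close>

lemma conn_diff2:
  assumes "N > 0"
  shows "of_nat N * (of_nat N - of_nat n - of_nat m) * (conn (Suc N) n m - conn N n m)
    = of_nat n * of_nat m * conn N n m"
proof -
  consider (gt) "n + m > N" | (eq) "N = n + m" | (lt) "n + m < N"
    by linarith
  then show ?thesis
  proof cases
    case lt
    then obtain j where j: "N = Suc (n + m + j)"
      using less_iff_Suc_add by blast
    show ?thesis
      by (simp add: conn_def j divide_simps power2_eq_square add_ac)
         (simp add: algebra_simps)
  qed (simp_all add: conn_def)
qed

section \<open>Reduction of rational numbers modulo a prime\<close>

text \<open>A relation with an arbitrary denominator \<open>d\<close> prime to \<open>p\<close>, so
  that sums and products need no lowest terms.\<close>

definition reduces :: "nat \<Rightarrow> rat \<Rightarrow> int \<Rightarrow> bool" where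
  "reduces p x a \<longleftrightarrow>
     (\<exists>c d. coprime d (int p) \<and> x * of_int d = of_int c \<and> [c = a * d] (mod int p))"

text \<open>Evaluating one rational number in two ways thus yields a congruence; this is how the
  main congruence arises.\<close>

lemma reduces_unique:
  assumes "reduces p x a" "reduces p x b"
  shows "[a = b] (mod int p)"
proof -
  obtain c d where c: "coprime d (int p)" "x * of_int d = of_int c" "[c = a * d] (mod int p)"
    using assms(1) by (auto simp: reduces_def)
  obtain c' d' where c': "coprime d' (int p)" "x * of_int d' = of_int c'" "[c' = b * d'] (mod int p)"
    using assms(2) by (auto simp: reduces_def)
  have "(of_int (c * d') :: rat) = of_int (c' * d)"
    using c(2) c'(2) by (metis (no_types, opaque_lifting) mult.assoc mult.commute of_int_mult)
  then have eq: "c * d' = c' * d"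
    by (simp only: of_int_eq_iff)
  have "[a * d * d' = c * d'] (mod int p)"
    using c(3) by (intro cong_scalar_right) (rule cong_sym)
  also have "c * d' = c' * d" by (fact eq)
  also have "[c' * d = b * d' * d] (mod int p)"
    using c'(3) by (intro cong_scalar_right)
  finally have "[a * (d * d') = b * (d * d')] (mod int p)"
    by (simp add: mult_ac)
  then show ?thesis
    using c(1) c'(1) by (simp add: cong_mult_rcancel)
qed

lemma reduces_of_int: "[a = b] (mod int p) \<Longrightarrow> reduces p (of_int a) b"
  unfolding reduces_def by (intro exI[of _ a] exI[of _ 1]) simp

lemma reduces_0: "reduces p 0 0" and reduces_1: "reduces p 1 1"
  using reduces_of_int[of 0 0 p] reduces_of_int[of 1 1 p] by simp_all

lemma reduces_add:
  assumes "reduces p x a" "reduces p y b"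
  shows "reduces p (x + y) (a + b)"
proof -
  obtain c d where c: "coprime d (int p)" "x * of_int d = of_int c" "[c = a * d] (mod int p)"
    using assms(1) by (auto simp: reduces_def)
  obtain c' d' where c': "coprime d' (int p)" "y * of_int d' = of_int c'" "[c' = b * d'] (mod int p)"
    using assms(2) by (auto simp: reduces_def)
  have "[c * d' + c' * d = (a * d) * d' + (b * d') * d] (mod int p)"
    using c(3) c'(3) by (intro cong_add cong_scalar_right)
  then have "[c * d' + c' * d = (a + b) * (d * d')] (mod int p)"
    by (simp add: algebra_simps)
  moreover have "(x + y) * of_int (d * d') = of_int (c * d' + c' * d)"
    using c(2) c'(2) by (simp add: algebra_simps)
  moreover have "coprime (d * d') (int p)"
    using c(1) c'(1) by simp
  ultimately show ?thesis
    unfolding reduces_def by blast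
qed

lemma reduces_mult:
  assumes "reduces p x a" "reduces p y b"
  shows "reduces p (x * y) (a * b)"
proof -
  obtain c d where c: "coprime d (int p)" "x * of_int d = of_int c" "[c = a * d] (mod int p)"
    using assms(1) by (auto simp: reduces_def)
  obtain c' d' where c': "coprime d' (int p)" "y * of_int d' = of_int c'" "[c' = b * d'] (mod int p)"
    using assms(2) by (auto simp: reduces_def)
  have "[c * c' = (a * b) * (d * d')] (mod int p)"
    using cong_mult[OF c(3) c'(3)] by (simp add: mult_ac)
  moreover have "(x * y) * of_int (d * d') = of_int (c * c')"
    using c(2) c'(2) by (simp flip: c(2) c'(2))
  moreover have "coprime (d * d') (int p)"
    using c(1) c'(1) by simp
  ultimately show ?thesis
    unfolding reduces_def by blast
qed

lemma reduces_power: "reduces p x a \<Longrightarrow> reduces p (x ^ k) (a ^ k)"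
  by (induction k) (auto intro: reduces_1 reduces_mult)

lemma reduces_sum:
  "(\<And>i. i \<in> A \<Longrightarrow> reduces p (f i) (g i)) \<Longrightarrow> reduces p (sum f A) (sum g A)"
  by (induction A rule: infinite_finite_induct) (auto intro: reduces_0 reduces_add)

lemma reduces_sum_list:
  "(\<And>x. x \<in> set xs \<Longrightarrow> reduces p (f x) (g x)) \<Longrightarrow>
    reduces p (sum_list (map f xs)) (sum_list (map g xs))"
  by (induction xs) (auto intro: reduces_0 reduces_add)

abbreviation rhterm :: "nat list \<Rightarrow> nat \<Rightarrow> rat" where
  "rhterm \<equiv> hterm (\<lambda>n. 1 / of_nat n)"

abbreviation phterm :: "nat \<Rightarrow> nat list \<Rightarrow> nat \<Rightarrow> int" where
  "phterm p \<equiv> hterm (\<lambda>n. modular_inverse (int p) (int n))"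

lemma coprime_int_prime:
  assumes "prime p" "0 < n" "n < p"
  shows "coprime (int n) (int p)"
  using assms by (meson coprime_commute coprime_int_iff nat_dvd_not_less prime_imp_coprime)

lemma reduces_hterm:
  assumes "prime p" "n < p"
  shows "reduces p (rhterm ks n) (phterm p ks n)"
  using assms(2)
proof (induction ks arbitrary: n)
  case Nil
  show ?case by (simp add: reduces_0 reduces_1)
next
  case (Cons k ks)
  show ?case
  \<comment> \<open>At 0 the inner sum is empty, so both sides vanish whatever the stand-in for
    \<open>1 / 0\<close> is.\<close>
  proof (cases "n = 0")
    case True
    then show ?thesis by (simp add: reduces_0)
  next
    case False
    have cop: "coprime (int n) (int p)"
      using coprime_int_prime[OF assms(1)] False Cons.prems by simp
    have "reduces p (1 / of_nat n) (modular_inverse (int p) (int n))"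
      unfolding reduces_def
      using False cop by (intro exI[of _ 1] exI[of _ "int n"])
         (simp add: cong_sym cong_modular_inverse2)
    then show ?thesis
      using Cons by (auto intro!: reduces_mult reduces_power reduces_sum)
  qed
qed

section \<open>Wilson's theorem and the connector modulo a prime\<close>

text \<open>Wilson's theorem is the case \<open>k = 0\<close>. The step moves one factor across,
  since \<open>p - 1 - k\<close> is congruent to \<open>- Suc k\<close>, and then cancels
  \<open>Suc k\<close>.\<close>

lemma wilson_fact:
  assumes "prime p" "k < p"
  shows "[fact k * fact (p - 1 - k) = (-1 :: int) ^ Suc k] (mod int p)"
  using assms(2)
proof (induction k)
  case 0
  then show ?case using wilson_theorem[OF assms(1)] by simp
next
  case (Suc k)
  have cop: "coprime (int (Suc k)) (int p)"
    using coprime_int_prime[OF assms(1)] Suc.prems by blast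
  have f: "(fact (p - 1 - k) :: int) = (int p - int (Suc k)) * fact (p - 1 - Suc k)"
  proof -
    have "p - 1 - k = Suc (p - 1 - Suc k)" "int (Suc (p - 1 - Suc k)) = int p - int (Suc k)"
      using Suc.prems by auto
    then show ?thesis by (metis fact_Suc)
  qed
  have "[int (Suc k) * (-1) ^ Suc (Suc k) = - int (Suc k) * (fact k * fact (p - 1 - k))] (mod int p)"
  proof -
    have "int (Suc k) * (-1) ^ Suc (Suc k) = - int (Suc k) * (-1) ^ Suc k"
      by (simp add: algebra_simps)
    then show ?thesis
      using Suc by (simp only: cong_scalar_left cong_sym Suc_lessD)
  qed
  also have "- int (Suc k) * (fact k * fact (p - 1 - k)) =
      (- (int p - int (Suc k))) * (fact (Suc k) * fact (p - 1 - Suc k))"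
    unfolding f by (simp add: algebra_simps)
  also have "[(- (int p - int (Suc k))) * (fact (Suc k) * fact (p - 1 - Suc k)) =
      int (Suc k) * (fact (Suc k) * fact (p - 1 - Suc k))] (mod int p)"
    by (intro cong_scalar_right) (simp add: cong_iff_dvd_diff)
  finally show ?case
    using cop by (simp only: cong_mult_lcancel) (rule cong_sym)
qed

text \<open>Paired as \<open>fact k * fact (p - 1 - k)\<close>, the factorials of numerator and
  denominator reduce to the same sign \<open>(-1) ^ (n + m)\<close>.\<close>

lemma reduces_conn:
  assumes "prime p"
  shows "reduces p (conn p n m) (of_bool (n + m < p))"
proof (cases "n + m < p")
  case True
  define c d :: int where "c = fact n * fact m * fact (p - 1 - n) * fact (p - 1 - m)"
    and "d = fact (n + m) * fact (p - 1) * fact (p - 1 - n - m)"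
  have "coprime (fact k :: int) (int p)" if "k < p" for k
    using assms that
    by (metis coprime_commute coprime_int_iff not_less of_nat_fact prime_dvd_fact_iff prime_imp_coprime)
  then have cop: "coprime d (int p)"
    using True by (simp add: d_def)
  have "[d = (fact (n + m) * fact (p - 1 - (n + m))) * fact (p - 1)] (mod int p)"
    by (simp add: d_def mult_ac)
  also have "[(fact (n + m) * fact (p - 1 - (n + m))) * fact (p - 1) = (-1) ^ Suc (n + m) * (-1)] (mod int p)"
    using True by (intro cong_mult wilson_fact wilson_theorem assms)
  also have "(-1) ^ Suc (n + m) * (-1) = (-1) ^ Suc n * ((-1) ^ Suc m :: int)"
    by (simp add: power_add)
  also have "[(-1) ^ Suc n * (-1) ^ Suc m =
      (fact n * fact (p - 1 - n)) * (fact m * fact (p - 1 - m) :: int)] (mod int p)"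
    using True by (intro cong_mult cong_sym[OF wilson_fact] assms) auto
  also have "(fact n * fact (p - 1 - n)) * (fact m * fact (p - 1 - m)) = c"
    by (simp add: c_def)
  finally have "[c = 1 * d] (mod int p)"
    by (simp add: cong_sym)
  moreover have "conn p n m * of_int d = of_int c"
    using True by (simp add: conn_def c_def d_def)
  ultimately show ?thesis
    using True cop unfolding reduces_def by auto
qed (simp add: conn_eq_0 reduces_0)


section \<open>Connected sums and the product \<open>\<star>\<close>\<close>

definition conn_sum :: "nat \<Rightarrow> nat list \<Rightarrow> nat list \<Rightarrow> rat" where
  "conn_sum N us vs = (\<Sum>n<N. \<Sum>m<N. rhterm us n * rhterm vs m * conn N n m)"

lemma conn_sum_commute: "conn_sum N us vs = conn_sum N vs us"
  unfolding conn_sum_def by (subst sum.swap) (simp add: conn_commute mult_ac)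

lemma conn_sum_Nil: "conn_sum N [] vs = (\<Sum>m<N. rhterm vs m)"
proof (cases N)
  case (Suc M)
  then have "conn_sum N [] vs = (\<Sum>n\<in>{0}. \<Sum>m<N. rhterm [] n * rhterm vs m * conn N n m)"
    unfolding conn_sum_def by (intro sum.mono_neutral_right) auto
  then show ?thesis
    by (simp add: conn_0_left)
qed (simp add: conn_sum_def)

section \<open>Growth of connected sums with the truncation\<close>

text \<open>The truncated \<open>n - 1\<close> at \<open>n = 0\<close> is harmless, as it multiplies
  an empty sum.\<close>

lemma summation_by_parts:
  fixes h c :: "nat \<Rightarrow> 'a::comm_ring_1"
  shows "(\<Sum>n<Suc N. (\<Sum>a<n. h a) * (c (n - 1) - c n)) = (\<Sum>a<N. h a * c a) - (\<Sum>a<N. h a) * c N"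
  by (induction N) (simp_all add: algebra_simps)

lemma conn_sum_by_parts:
  "(\<Sum>n<Suc N. (\<Sum>a<n. h a) * (conn N (n - 1) m - conn N n m)) = (\<Sum>a<N. h a * conn N a m)"
  using summation_by_parts[of h "\<lambda>n. conn N n m" N] by (simp add: conn_eq_0 del: sum.lessThan_Suc)

text \<open>In \<open>conn_sum N\<close> the terms with \<open>n = N\<close> or \<open>m = N\<close>
  have connector 0, so both sums share one range and only the connector changes.\<close>

lemma conn_sum_Suc_diff:
  "conn_sum (Suc N) us vs - conn_sum N us vs =
    (\<Sum>m<Suc N. rhterm vs m * (\<Sum>n<Suc N. rhterm us n * (conn (Suc N) n m - conn N n m)))"
proof -
  have "conn_sum N us vs = (\<Sum>n<Suc N. \<Sum>m<Suc N. rhterm us n * rhterm vs m * conn N n m)"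
    unfolding conn_sum_def by (simp add: conn_eq_0)
  also have "\<dots> = (\<Sum>m<Suc N. \<Sum>n<Suc N. rhterm us n * rhterm vs m * conn N n m)"
    by (rule sum.swap)
  finally have 1: "conn_sum N us vs = \<dots>" .
  have 2: "conn_sum (Suc N) us vs =
      (\<Sum>m<Suc N. \<Sum>n<Suc N. rhterm us n * rhterm vs m * conn (Suc N) n m)"
    unfolding conn_sum_def by (rule sum.swap)
  show ?thesis
    unfolding 1 2 sum_subtractf[symmetric] sum_distrib_left
    by (intro sum.cong refl) (simp add: algebra_simps)
qed

lemma conn_sum_z2:
  assumes "N > 0"
  shows "conn_sum (Suc N) (2 # us) vs - conn_sum N (2 # us) vs = conn_sum N us vs / (of_nat N)\<^sup>2"
proof -
  have step: "rhterm (2 # us) n * (conn (Suc N) n m - conn N n m) =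
      (\<Sum>a<n. rhterm us a) * (conn N (n - 1) m - conn N n m) / (of_nat N)\<^sup>2" for n m
  proof (cases n)
    case (Suc k)
    then show ?thesis
      using conn_diff[OF assms, of k m] assms
      by (simp add: divide_simps del: of_nat_Suc) (simp add: mult_ac)
  qed simp
  have "conn_sum (Suc N) (2 # us) vs - conn_sum N (2 # us) vs =
      (\<Sum>m<Suc N. rhterm vs m * (\<Sum>a<N. rhterm us a * conn N a m)) / (of_nat N)\<^sup>2"
    unfolding conn_sum_Suc_diff step
    by (simp only: conn_sum_by_parts sum_divide_distrib[symmetric] times_divide_eq_right)
  also have "(\<Sum>m<Suc N. rhterm vs m * (\<Sum>a<N. rhterm us a * conn N a m)) =
      (\<Sum>m<N. rhterm vs m * (\<Sum>a<N. rhterm us a * conn N a m))"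
    by (simp add: conn_eq_0)
  also have "\<dots> = conn_sum N us vs"
    unfolding conn_sum_def sum_distrib_left by (subst sum.swap) (simp add: mult_ac)
  finally show ?thesis .
qed

text \<open>Each increment splits into two differences, summed by \<open>conn_sum_by_parts\<close>,
  and a term in which the factor \<open>n * m\<close> of \<open>conn_diff2\<close> lowers both
  exponents from 3 to 2.\<close>

lemma conn_sum_z3_z3:
  assumes "N > 0"
  shows "conn_sum (Suc N) (3 # us) (3 # vs) - conn_sum N (3 # us) (3 # vs) =
    (conn_sum N us (3 # vs) + conn_sum N (3 # us) vs) / of_nat N ^ 3
      + conn_sum N (2 # us) (2 # vs) / (of_nat N)\<^sup>2"
proof -
  define S T :: "nat \<Rightarrow> rat" where "S = (\<lambda>n. \<Sum>a<n. rhterm us a)" and "T = (\<lambda>m. \<Sum>a<m. rhterm vs a)"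
  have h: "rhterm (k # us) n = S n / of_nat n ^ k" "rhterm (k # vs) m = T m / of_nat m ^ k" for k n m
    by (simp_all add: S_def T_def power_divide)
  have "rhterm (3 # vs) m * (rhterm (3 # us) n * (conn (Suc N) n m - conn N n m)) =
      (rhterm (3 # vs) m * (S n * (conn N (n - 1) m - conn N n m)) +
       rhterm (3 # us) n * (T m * (conn N (m - 1) n - conn N m n))) / of_nat N ^ 3 +
      rhterm (2 # us) n * rhterm (2 # vs) m * conn N n m / (of_nat N)\<^sup>2" for n m
  proof (cases "n = 0 \<or> m = 0")
    case True
    then show ?thesis by (auto simp: S_def T_def)
  next
    case False
    define x y z D :: rat where "x = of_nat n" and "y = of_nat m" and "z = of_nat N"
      and "D = conn (Suc N) n m - conn N n m"
    have nz: "x \<noteq> 0" "y \<noteq> 0" "z \<noteq> 0"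
      using False assms by (auto simp: x_def y_def z_def)
    have "z\<^sup>2 * D = x\<^sup>2 * (conn N (n - 1) m - conn N n m)"
      using conn_diff[OF assms, of "n - 1" m] False by (simp add: x_def z_def D_def)
    then have 1: "conn N (n - 1) m - conn N n m = z\<^sup>2 * D / x\<^sup>2"
      using nz by simp
    have "z\<^sup>2 * D = y\<^sup>2 * (conn N (m - 1) n - conn N m n)"
      using conn_diff[OF assms, of "m - 1" n] False
      by (simp add: y_def z_def D_def conn_commute[of _ n])
    then have 2: "conn N (m - 1) n - conn N m n = z\<^sup>2 * D / y\<^sup>2"
      using nz by simp
    have 3: "conn N n m = z * (z - x - y) * D / (x * y)"
      using conn_diff2[OF assms, of n m] nz by (simp add: x_def y_def z_def D_def)
    \<comment> \<open>With \<open>D / (x ^ 3 * y ^ 3)\<close> taken out, this is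
      \<open>1 = x / z + y / z + (z - x - y) / z\<close>.\<close>
    show ?thesis
      unfolding h 1 2 D_def[symmetric] x_def[symmetric] y_def[symmetric] z_def[symmetric]
      unfolding 3 using nz
      by (simp add: divide_simps power2_eq_square power3_eq_cube) (simp add: algebra_simps)
  qed
  then have "conn_sum (Suc N) (3 # us) (3 # vs) - conn_sum N (3 # us) (3 # vs) =
      (\<Sum>m<Suc N. \<Sum>n<Suc N. 
      (rhterm (3 # vs) m * (S n * (conn N (n - 1) m - conn N n m)) +
       rhterm (3 # us) n * (T m * (conn N (m - 1) n - conn N m n))) / of_nat N ^ 3 +
      rhterm (2 # us) n * rhterm (2 # vs) m * conn N n m / (of_nat N)\<^sup>2)"
    unfolding conn_sum_Suc_diff sum_distrib_left by (intro sum.cong refl)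
  also have "\<dots> =
      ((\<Sum>m<Suc N. \<Sum>n<Suc N. rhterm (3 # vs) m * (S n * (conn N (n - 1) m - conn N n m))) +
       (\<Sum>m<Suc N. \<Sum>n<Suc N. rhterm (3 # us) n * (T m * (conn N (m - 1) n - conn N m n)))) / of_nat N ^ 3 +
      (\<Sum>m<Suc N. \<Sum>n<Suc N. rhterm (2 # us) n * rhterm (2 # vs) m * conn N n m) / (of_nat N)\<^sup>2"
    by (simp only: sum.distrib sum_divide_distrib[symmetric])
  also have "(\<Sum>m<Suc N. \<Sum>n<Suc N. rhterm (3 # vs) m * (S n * (conn N (n - 1) m - conn N n m)))
      = (\<Sum>m<Suc N. rhterm (3 # vs) m * (\<Sum>a<N. rhterm us a * conn N a m))"
    unfolding S_def sum_distrib_left[symmetric] conn_sum_by_parts ..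
  also have "\<dots> = (\<Sum>m<N. rhterm (3 # vs) m * (\<Sum>a<N. rhterm us a * conn N a m))"
    by (simp add: conn_eq_0)
  also have "\<dots> = conn_sum N us (3 # vs)"
    unfolding conn_sum_def sum_distrib_left by (subst sum.swap) (simp add: mult_ac)
  also have "(\<Sum>m<Suc N. \<Sum>n<Suc N. rhterm (3 # us) n * (T m * (conn N (m - 1) n - conn N m n)))
      = (\<Sum>n<Suc N. rhterm (3 # us) n * (\<Sum>a<N. rhterm vs a * conn N a n))"
    by (subst sum.swap) (unfold T_def sum_distrib_left[symmetric] conn_sum_by_parts, rule refl)
  also have "\<dots> = (\<Sum>n<N. rhterm (3 # us) n * (\<Sum>a<N. rhterm vs a * conn N n a))"
    by (simp add: conn_eq_0 conn_commute)
  also have "\<dots> = conn_sum N (3 # us) vs"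
    unfolding conn_sum_def sum_distrib_left by (simp add: mult_ac)
  also have "(\<Sum>m<Suc N. \<Sum>n<Suc N. rhterm (2 # us) n * rhterm (2 # vs) m * conn N n m)
      = (\<Sum>m<N. \<Sum>n<N. rhterm (2 # us) n * rhterm (2 # vs) m * conn N n m)"
    by (simp add: conn_eq_0)
  also have "\<dots> = conn_sum N (2 # us) (2 # vs)"
    unfolding conn_sum_def by (rule sum.swap)
  finally show ?thesis .
qed

lemma conn_sum_1_Cons: "conn_sum (Suc 0) (k # us) vs = 0"
  by (simp add: conn_sum_def)

text \<open>
  The reversed index lists of the monomials of \<^const>\<open>star_rev\<close>, with multiplicity.
\<close>

fun star_words :: "nat list \<Rightarrow> nat list \<Rightarrow> nat list list" where
  "star_words [] vs = [vs]"
| "star_words (a # us) [] = [a # us]"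
| "star_words (a # us) (b # vs) =
     (if a = 2 then map ((#) 2) (star_words us (b # vs))
      else if b = 2 then map ((#) 2) (star_words (a # us) vs)
      else map ((#) 3) (star_words us (b # vs)) @ map ((#) 3) (star_words (a # us) vs)
        @ map (\<lambda>ws. 2 # 2 # 2 # ws) (star_words us vs))"

lemma sum_list_zword_Cons:
  "(\<Sum>ws\<leftarrow>L. zword (rev (k # ws))) = (\<Sum>ws\<leftarrow>L. zword (rev ws)) * zgen k"
  by (induction L) (simp_all add: zword_snoc distrib_right)

lemma star_rev_eq_sum_list: "star_rev us vs = (\<Sum>ws\<leftarrow>star_words us vs. zword (rev ws))"
proof (induction us vs rule: star_words.induct)
  case (3 a us b vs)
  have "(\<Sum>ws\<leftarrow>L. zword (rev (2 # 2 # 2 # ws))) = (\<Sum>ws\<leftarrow>L. zword (rev ws)) * zgen 2 ^ 3" for L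
    by (induction L) (simp_all add: zword_append zword_def distrib_right power3_eq_cube mult.assoc)
  with 3 show ?case
    by (simp add: comp_def sum_list_zword_Cons del: rev.simps)
qed simp_all

lemma star_words_subset_lists:
  assumes "us \<in> lists S" "vs \<in> lists S" "2 \<in> S" "3 \<in> S"
  shows "set (star_words us vs) \<subseteq> lists S"
  using assms(1,2)
proof (induction us vs rule: star_words.induct)
  case (3 a us b vs)
  have lists: "us \<in> lists S" "vs \<in> lists S"
    using "3.prems" by (simp_all del: in_lists_conv_set)
  consider "a = 2" | "a \<noteq> 2" "b = 2" | "a \<noteq> 2" "b \<noteq> 2"
    by blast
  then show ?case
  proof cases
    case 1
    then show ?thesis
      using "3.IH"(1)[OF 1 lists(1) "3.prems"(2)] assms(3)
      by (fastforce simp: lists_eq_set)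
  next
    case 2
    then show ?thesis
      using "3.IH"(2)[OF 2 "3.prems"(1) lists(2)] assms(3)
      by (fastforce simp: lists_eq_set)
  next
    case 3
    then show ?thesis
      using "3.IH"(3)[OF 3 lists(1) "3.prems"(2)] "3.IH"(4)[OF 3 "3.prems"(1) lists(2)]
        "3.IH"(5)[OF 3 lists] assms(3,4)
      by (fastforce simp: lists_eq_set)
  qed
qed simp_all

section \<open>Multiple harmonic sums and induction on the truncation\<close>

definition mhs :: "nat \<Rightarrow> nat list \<Rightarrow> rat" where
  "mhs N ks = (\<Sum>n<N. rhterm ks n)"

lemma mhs_Suc_Cons: "mhs (Suc N) (k # ks) = mhs N (k # ks) + mhs N ks / of_nat N ^ k"
  by (simp add: mhs_def power_divide)

lemma sum_list_mhs_Suc_Cons: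
  "(\<Sum>x\<leftarrow>L. mhs (Suc N) (k # f x)) = (\<Sum>x\<leftarrow>L. mhs N (k # f x)) + (\<Sum>x\<leftarrow>L. mhs N (f x)) / of_nat N ^ k"
  by (induction L) (simp_all add: mhs_Suc_Cons add_divide_distrib)

lemma mhs_1_Cons: "mhs (Suc 0) (k # ks) = 0"
  by (simp add: mhs_def)

text \<open>Both sides vanish at \<open>N = 1\<close> and have equal increments, by
  \<open>conn_sum_z2\<close> and \<open>mhs_Suc_Cons\<close>.\<close>

lemma conn_sum_Cons_2:
  assumes "\<And>N. N > 0 \<Longrightarrow> conn_sum N us vs = (\<Sum>ws\<leftarrow>L. mhs N ws)" and "N > 0"
  shows "conn_sum N (2 # us) vs = (\<Sum>ws\<leftarrow>L. mhs N (2 # ws))"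
  using assms(2)
proof (induction N rule: nat_induct_non_zero)
  case 1
  show ?case by (simp add: conn_sum_1_Cons mhs_1_Cons)
next
  case (Suc N)
  then show ?case
    using conn_sum_z2[of N us vs] assms(1)[of N]
    by (simp add: sum_list_mhs_Suc_Cons)
qed

lemma conn_sum_eq:
  assumes "us \<in> lists {2, 3}" "vs \<in> lists {2, 3}" "N > 0"
  shows "conn_sum N us vs = (\<Sum>ws\<leftarrow>star_words us vs. mhs N ws)"
  using assms
proof (induction us vs arbitrary: N rule: star_words.induct)
  case (1 vs)
  show ?case by (simp add: conn_sum_Nil mhs_def)
next
  case (2 a us)
  show ?case by (simp add: conn_sum_commute[of _ _ "[]"] conn_sum_Nil mhs_def)
next
  case (3 a us b vs)
  have lists: "us \<in> lists {2, 3}" "vs \<in> lists {2, 3}"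
    using "3.prems" by auto
  consider "a = 2" | "a \<noteq> 2" "b = 2" | "a = 3" "b = 3"
    using "3.prems" by auto
  then show ?case
  proof cases
    case 1
    then show ?thesis
      using conn_sum_Cons_2[OF "3.IH"(1)[OF 1 lists(1) "3.prems"(2)] "3.prems"(3)]
      by (simp add: comp_def)
  next
    case 2
    have "conn_sum N vs (a # us) = (\<Sum>ws\<leftarrow>star_words (a # us) vs. mhs N ws)" if "N > 0" for N
      using "3.IH"(2)[OF 2 "3.prems"(1) lists(2) that] by (simp add: conn_sum_commute)
    from conn_sum_Cons_2[OF this "3.prems"(3)] show ?thesis
      using 2 by (simp add: comp_def conn_sum_commute[of _ _ "2 # _"])
  next
    case 3
    then have ne: "a \<noteq> 2" "b \<noteq> 2" by auto
    note IH3 = "3.IH"(3)[OF ne lists(1) "3.prems"(2)]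
      and IH4 = "3.IH"(4)[OF ne "3.prems"(1) lists(2)]
      and IH5 = "3.IH"(5)[OF ne lists]
    let ?W = "star_words us vs"
    \<comment> \<open>Prepending 2 on each side gives two letters of \<open>z_2 ^ 3\<close>; the
      third comes from the factor \<open>1 / N ^ 2\<close> in \<open>conn_sum_z3_z3\<close>.\<close>
    have "conn_sum N us (2 # vs) = (\<Sum>ws\<leftarrow>map ((#) 2) ?W. mhs N ws)" if "N > 0" for N
      using conn_sum_Cons_2[of vs us ?W N] IH5 that
      by (simp add: comp_def conn_sum_commute[of _ _ "2 # _"] conn_sum_commute[of _ vs])
    from conn_sum_Cons_2[OF this]
    have IH22: "conn_sum N (2 # us) (2 # vs) = (\<Sum>ws\<leftarrow>?W. mhs N (2 # 2 # ws))" if "N > 0" for N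
      using that by (simp add: comp_def)
    show ?thesis
      using "3.prems"(3)
    proof (induction N rule: nat_induct_non_zero)
      case 1
      show ?case
        using 3 by (simp add: conn_sum_1_Cons mhs_1_Cons comp_def)
    next
      case (Suc N)
      show ?case
        using Suc conn_sum_z3_z3[of N us vs] IH3[of N] IH4[of N] IH22[of N] 3
        by (simp add: sum_list_mhs_Suc_Cons comp_def add_divide_distrib eq_diff_eq diff_eq_eq add_ac)
    qed
  qed
qed

section \<open>Sums modulo a prime\<close>

text \<open>Splitting off the last, largest entry \<open>n\<close> leaves an increasing list bounded
  by \<open>n\<close>, so the induction varies \<open>N\<close>.\<close>

lemma sum_increasing_lists_eq_hterm:
  fixes g :: "nat \<Rightarrow> 'a::comm_semiring_1"
  assumes "N > 0"
  shows "(\<Sum>ns | length ns = length ks \<and> sorted_wrt (<) ns \<and> set ns \<subseteq> {0<..<N}.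
     \<Prod>i<length ks. g (ns ! i) ^ (ks ! i)) = (\<Sum>n<N. hterm g (rev ks) n)"
  using assms
proof (induction ks arbitrary: N rule: rev_induct)
  case Nil
  have "{ns :: nat list. length ns = 0 \<and> sorted_wrt (<) ns \<and> set ns \<subseteq> {0<..<N}} = {[]}"
    by auto
  then show ?case using Nil by simp
next
  case (snoc k ks)
  define T where "T = (\<lambda>r N. {ns. length ns = r \<and> sorted_wrt (<) ns \<and> set ns \<subseteq> {0<..<N :: nat}})"
  have fin: "finite (T r N)" for r N
    by (rule finite_subset[OF _ finite_lists_length_eq[of "{0<..<N}" r]]) (auto simp: T_def)
  let ?f = "\<lambda>ns. (\<Prod>i<length (ks @ [k]). g (ns ! i) ^ ((ks @ [k]) ! i))"
  have T_Suc: "ns @ [n] \<in> T (Suc r) N \<longleftrightarrow> n \<in> {0<..<N} \<and> ns \<in> T r n" for ns n r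
    by (fastforce simp: T_def sorted_wrt_append)
  have butlast_last: "butlast ns @ [last ns] = ns" if "ns \<in> T (Suc r) N" for ns r
    using that by (intro append_butlast_last_id) (auto simp: T_def)
  have "sum ?f (T (Suc (length ks)) N) =
      (\<Sum>(n, ns)\<in>Sigma {0<..<N} (T (length ks)). ?f (ns @ [n]))"
  proof (rule sum.reindex_bij_witness[where j = "\<lambda>ns. (last ns, butlast ns)" and
        i = "\<lambda>(n, ns). ns @ [n]"], goal_cases)
    case (2 ns)
    with T_Suc[of "butlast ns" "last ns"] butlast_last[OF 2] show ?case
      by auto
  qed (auto simp: T_Suc butlast_last)
  also have "\<dots> = (\<Sum>n\<in>{0<..<N}. \<Sum>ns\<in>T (length ks) n. ?f (ns @ [n]))"
    by (rule sum.Sigma[symmetric]) (auto simp: fin)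
  also have "\<dots> = (\<Sum>n\<in>{0<..<N}. g n ^ k *
      (\<Sum>ns\<in>T (length ks) n. \<Prod>i<length ks. g (ns ! i) ^ (ks ! i)))"
    unfolding sum_distrib_left
    by (intro sum.cong refl) (auto simp: T_def nth_append mult.commute intro!: prod.cong)
  also have "\<dots> = (\<Sum>n\<in>{0<..<N}. hterm g (rev (ks @ [k])) n)"
    using snoc.IH by (intro sum.cong refl) (simp add: T_def)
  also have "\<dots> = (\<Sum>n<N. hterm g (rev (ks @ [k])) n)"
    by (intro sum.mono_neutral_left) (auto simp: not_less)
  finally show ?case by (simp add: T_def)
qed

lemma zeta_p_eq_sum: "p > 0 \<Longrightarrow> zeta_p p ks = (\<Sum>n<p. phterm p (rev ks) n)"
  unfolding zeta_p_def by (rule sum_increasing_lists_eq_hterm)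

text \<open>Multiplied by the unit \<open>n\<close>, which is congruent to \<open>-(p - n)\<close>,
  both sides become \<open>-1\<close>.\<close>

lemma modular_inverse_diff_cong:
  assumes "prime p" "0 < n" "n < p"
  shows "[modular_inverse (int p) (int (p - n)) = - modular_inverse (int p) (int n)] (mod int p)"
proof -
  note cop = coprime_int_prime[OF assms(1)]
  have "[int n * modular_inverse (int p) (int (p - n))
      = - (int (p - n) * modular_inverse (int p) (int (p - n)))] (mod int p)"
    using assms(3) by (simp add: cong_iff_dvd_diff algebra_simps)
  also have "[- (int (p - n) * modular_inverse (int p) (int (p - n))) = - 1] (mod int p)"
    using assms by (subst cong_minus_minus_iff) (intro cong_modular_inverse1 cop; simp)
  also have "[- 1 = - (int n * modular_inverse (int p) (int n))] (mod int p)"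
    using assms by (subst cong_minus_minus_iff) (intro cong_sym[OF cong_modular_inverse1] cop)
  finally have "[int n * modular_inverse (int p) (int (p - n))
      = int n * - modular_inverse (int p) (int n)] (mod int p)"
    by simp
  then show ?thesis
    using cop[of n] assms by (simp only: cong_mult_lcancel)
qed

text \<open>This is \<open>conn_sum\<close> modulo \<open>p\<close>, with the connector replaced by
  its residue from \<open>reduces_conn\<close>.\<close>

definition tri_sum :: "nat \<Rightarrow> nat list \<Rightarrow> nat list \<Rightarrow> int" where
  "tri_sum p us vs = (\<Sum>n<p. \<Sum>m<p. phterm p us n * phterm p vs m * of_bool (n + m < p))"

lemma tri_sum_commute: "tri_sum p us vs = tri_sum p vs us"
  unfolding tri_sum_def by (subst sum.swap) (simp add: mult_ac add.commute)

lemma tri_sum_Nil_right: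
  assumes "p > 0"
  shows "tri_sum p us [] = (\<Sum>n<p. phterm p us n)"
proof -
  have "tri_sum p us [] = (\<Sum>n<p. \<Sum>m\<in>{0}. phterm p us n * phterm p [] m * of_bool (n + m < p))"
    unfolding tri_sum_def using assms by (intro sum.cong refl sum.mono_neutral_right) auto
  then show ?thesis by simp
qed

text \<open>The top variable is constrained only by \<open>a < n < p - m\<close>, and reflecting it
  in \<open>p\<close> exchanges the roles of \<open>a\<close> and \<open>m\<close>.\<close>

lemma tri_sum_Cons_left:
  "tri_sum p (k # us) vs = (\<Sum>a<p. \<Sum>m<p. phterm p us a * phterm p vs m *
     (\<Sum>n\<in>{a<..<p - m}. modular_inverse (int p) (int n) ^ k))"
proof -
  let ?g = "\<lambda>n. modular_inverse (int p) (int n) ^ k"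
  have "tri_sum p (k # us) vs =
      (\<Sum>n<p. \<Sum>m<p. \<Sum>a<p. phterm p us a * phterm p vs m * (?g n * of_bool (a < n \<and> n + m < p)))"
    unfolding tri_sum_def
  proof (intro sum.cong refl)
    fix n m assume "n \<in> {..<p}"
    then have "(\<Sum>a<n. phterm p us a) = (\<Sum>a<p. phterm p us a * of_bool (a < n))"
      by (intro sum.mono_neutral_cong_left) auto
    then show "phterm p (k # us) n * phterm p vs m * of_bool (n + m < p) =
        (\<Sum>a<p. phterm p us a * phterm p vs m * (?g n * of_bool (a < n \<and> n + m < p)))"
      by (simp add: sum_distrib_left sum_distrib_right of_bool_conj mult_ac)
  qed
  also have "\<dots> =
      (\<Sum>a<p. \<Sum>m<p. \<Sum>n<p. phterm p us a * phterm p vs m * (?g n * of_bool (a < n \<and> n + m < p)))"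
    by (subst sum.swap, subst (2) sum.swap) (subst sum.swap, rule refl)
  also have "\<dots> = (\<Sum>a<p. \<Sum>m<p. phterm p us a * phterm p vs m * (\<Sum>n\<in>{a<..<p - m}. ?g n))"
    unfolding sum_distrib_left[symmetric]
    by (intro sum.cong refl arg_cong2[where f = "(*)"] sum.mono_neutral_cong_right) auto
  finally show ?thesis .
qed

text \<open>The substitution \<open>n \<mapsto> p - n\<close> in the innermost sum of \<open>tri_sum_Cons_left\<close>.\<close>

lemma tri_sum_move:
  assumes "prime p"
  shows "[tri_sum p us (k # vs) = (-1) ^ k * tri_sum p (k # us) vs] (mod int p)"
proof -
  let ?i = "\<lambda>n. modular_inverse (int p) (int n)"
  have 1: "tri_sum p us (k # vs) =
      (\<Sum>a<p. \<Sum>m<p. phterm p us a * phterm p vs m * (\<Sum>n\<in>{m<..<p - a}. ?i n ^ k))"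
    unfolding tri_sum_commute[of p us] tri_sum_Cons_left by (subst sum.swap) (simp add: mult_ac)
  have 2: "[(\<Sum>a<p. \<Sum>m<p. phterm p us a * phterm p vs m * (\<Sum>n\<in>{m<..<p - a}. ?i n ^ k)) =
      (\<Sum>a<p. \<Sum>m<p. phterm p us a * phterm p vs m * ((-1) ^ k * (\<Sum>n\<in>{a<..<p - m}. ?i n ^ k)))] (mod int p)"
  proof (intro cong_sum cong_scalar_left)
    fix a m
    have "(\<Sum>n\<in>{m<..<p - a}. ?i n ^ k) = (\<Sum>n\<in>{a<..<p - m}. ?i (p - n) ^ k)"
      by (rule sum.reindex_bij_witness[where i = "\<lambda>n. p - n" and j = "\<lambda>n. p - n"]) auto
    also have "[\<dots> = (\<Sum>n\<in>{a<..<p - m}. (- ?i n) ^ k)] (mod int p)"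
      by (intro cong_sum cong_pow modular_inverse_diff_cong assms) auto
    also have "(\<Sum>n\<in>{a<..<p - m}. (- ?i n) ^ k) = (-1) ^ k * (\<Sum>n\<in>{a<..<p - m}. ?i n ^ k)"
      by (simp add: sum_distrib_left power_minus[of "?i _"])
    finally show "[(\<Sum>n\<in>{m<..<p - a}. ?i n ^ k) = (-1) ^ k * (\<Sum>n\<in>{a<..<p - m}. ?i n ^ k)] (mod int p)" .
  qed
  have 3: "(\<Sum>a<p. \<Sum>m<p. phterm p us a * phterm p vs m *
      ((-1) ^ k * (\<Sum>n\<in>{a<..<p - m}. ?i n ^ k))) = (-1) ^ k * tri_sum p (k # us) vs"
    by (simp only: tri_sum_Cons_left mult.left_commute[of _ "(-1) ^ k"] sum_distrib_left[of "(-1) ^ k", symmetric])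
  show ?thesis
    using 2 unfolding 1 3 .
qed

text \<open>\<open>tri_sum_move\<close> shifts the letters of \<open>vs\<close> one at a time onto
  \<open>us\<close>, reversing their order and collecting the sign.\<close>

lemma tri_sum_cong:
  assumes "prime p"
  shows "[(-1) ^ sum_list vs * (\<Sum>n<p. phterm p (rev vs @ us) n) = tri_sum p us vs] (mod int p)"
proof (induction vs arbitrary: us)
  case Nil
  show ?case
    using prime_gt_0_nat[OF assms] by (simp add: tri_sum_Nil_right)
next
  case (Cons k vs)
  have "[(-1) ^ k * ((-1) ^ sum_list vs * (\<Sum>n<p. phterm p (rev vs @ k # us) n))
      = (-1) ^ k * tri_sum p (k # us) vs] (mod int p)"
    by (rule cong_scalar_left[OF Cons.IH])
  also have "[(-1) ^ k * tri_sum p (k # us) vs = tri_sum p us (k # vs)] (mod int p)"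
    by (rule cong_sym[OF tri_sum_move[OF assms]])
  finally show ?case
    by (simp add: power_add mult_ac)
qed

section \<open>From congruences at primes to the quotient ring\<close>

lemma sum_list_zeta_A:
  "(\<Sum>ks\<leftarrow>L. zeta_A ks) = abs_ring_A (abs_prod_Zp (\<lambda>p. \<Sum>ks\<leftarrow>L. zeta_p p ks))"
proof (induction L)
  case Nil
  show ?case by (simp add: zero_ring_A_def zero_prod_Zp_def)
next
  case (Cons ks L)
  then show ?case
    by (simp add: zeta_A_def plus_ring_A.abs_eq plus_prod_Zp.abs_eq)
qed

lemma neg_one_power_zeta_A:
  "(-1) ^ k * zeta_A ks = abs_ring_A (abs_prod_Zp (\<lambda>p. (-1) ^ k * zeta_p p ks))"
  by (cases "even k") (simp_all add: zeta_A_def uminus_ring_A.abs_eq uminus_prod_Zp.abs_eq)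

lemma abs_ring_A_eqI:
  assumes "\<And>p. prime p \<Longrightarrow> [f p = g p] (mod int p)"
  shows "abs_ring_A (abs_prod_Zp f) = abs_ring_A (abs_prod_Zp g)"
proof -
  have "abs_prod_Zp f = abs_prod_Zp g"
    unfolding prod_Zp.abs_eq_iff prod_rel_def using assms by blast
  then show ?thesis by simp
qed

lemma Z_A_sum_list: "Z_A (\<Sum>x\<leftarrow>xs. f x) = (\<Sum>x\<leftarrow>xs. Z_A (f x))"
proof (induction xs)
  case Nil
  show ?case using Z_A_add[of 0 0] by simp
qed (simp add: Z_A_add)


lemma reduces_conn_sum:
  assumes "prime p"
  shows "reduces p (conn_sum p us vs) (tri_sum p us vs)"
  unfolding conn_sum_def tri_sum_def
  using assms by (intro reduces_sum reduces_mult reduces_hterm reduces_conn) auto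

lemma reduces_mhs:
  assumes "prime p"
  shows "reduces p (mhs p ks) (zeta_p p (rev ks))"
  using assms prime_gt_0_nat[OF assms]
  by (auto simp: mhs_def zeta_p_eq_sum intro!: reduces_sum reduces_hterm)

lemma zeta_p_star_words:
  assumes "w1 \<in> lists {2, 3}" "w2 \<in> lists {2, 3}" "prime p"
  shows "[(-1) ^ wt w2 * zeta_p p (w1 @ rev w2) =
    (\<Sum>ws\<leftarrow>star_words (rev w1) (rev w2). zeta_p p (rev ws))] (mod int p)"
proof -
  have p: "p > 0"
    using assms(3) by (rule prime_gt_0_nat)
  \<comment> \<open>Here \<open>rev (rev w2) @ rev w1\<close> is the reversal of
    \<open>w1 @ rev w2\<close>.\<close>
  have "[(-1) ^ wt w2 * zeta_p p (w1 @ rev w2) = tri_sum p (rev w1) (rev w2)] (mod int p)"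
    using tri_sum_cong[OF assms(3), of "rev w2" "rev w1"] p by (simp add: zeta_p_eq_sum wt_def)
  also have "[tri_sum p (rev w1) (rev w2) =
      (\<Sum>ws\<leftarrow>star_words (rev w1) (rev w2). zeta_p p (rev ws))] (mod int p)"
  proof (rule reduces_unique)
    show "reduces p (conn_sum p (rev w1) (rev w2)) (tri_sum p (rev w1) (rev w2))"
      by (rule reduces_conn_sum[OF assms(3)])
    have "conn_sum p (rev w1) (rev w2) = (\<Sum>ws\<leftarrow>star_words (rev w1) (rev w2). mhs p ws)"
      using assms p by (intro conn_sum_eq) auto
    then show "reduces p (conn_sum p (rev w1) (rev w2))
        (\<Sum>ws\<leftarrow>star_words (rev w1) (rev w2). zeta_p p (rev ws))"
      using reduces_mhs[OF assms(3)] by (simp add: reduces_sum_list)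
  qed
  finally show ?thesis .
qed

theorem corollary1p5:
  fixes w1 w2 :: "nat list"
  assumes "w1 \<in> lists {2, 3}" and "w2 \<in> lists {2, 3}"
  shows "(-1) ^ wt w2 * Z_A (zword w1 * zword (rev w2)) = Z_A (zword w1 \<star> zword w2)"
proof -
  let ?W = "star_words (rev w1) (rev w2)"
  have pos: "ks \<in> lists {0<..}" if "ks \<in> lists {2, 3}" for ks :: "nat list"
    using that by (induction ks) auto
  have W: "rev ws \<in> lists {0<..}" if "ws \<in> set ?W" for ws
  proof -
    have "rev w1 \<in> lists {2, 3}" "rev w2 \<in> lists {2, 3}"
      using assms by auto
    then have "ws \<in> lists {2, 3}"
      using star_words_subset_lists[of "rev w1" "{2, 3}" "rev w2"] that by blast
    then show ?thesis
      using pos[of ws] by auto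
  qed
  have "(-1) ^ wt w2 * Z_A (zword w1 * zword (rev w2)) = (-1) ^ wt w2 * zeta_A (w1 @ rev w2)"
  proof -
    have "w1 @ rev w2 \<in> lists {0<..}"
      by (rule pos) (use assms in auto)
    then show ?thesis
      by (simp only: Z_A_zword zword_append[symmetric])
  qed
  also have "\<dots> = (\<Sum>ks\<leftarrow>map rev ?W. zeta_A ks)"
    unfolding neg_one_power_zeta_A sum_list_zeta_A
    using zeta_p_star_words[OF assms] by (intro abs_ring_A_eqI) (simp add: comp_def)
  also have "\<dots> = (\<Sum>ws\<leftarrow>?W. Z_A (zword (rev ws)))"
    using W by (auto simp: comp_def Z_A_zword intro!: arg_cong[where f = sum_list])
  also have "\<dots> = Z_A (zword w1 \<star> zword w2)"
    by (simp only: star_zword[OF assms] star_rev_eq_sum_list Z_A_sum_list)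
  finally show ?thesis .
qed

end
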